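(* Let $(\alpha,\beta)\in[0,1]^2$ and suppose $\beta\geq\min(2\alpha,1)$. Then both of the following hold. (a) There exists a set $A\subset\mathbb{N}$ of positive integers such that the asymptotic densities $\mathrm{d}(A)$ and $\mathrm{d}(A+A)$ exist and $\mathrm{d}(A)=\alpha$, $\mathrm{d}(A+A)=\beta$. (b) There exists a measurable set $A\subset\mathbb{T}=\mathbb{R}/\mathbb{Z}$ such that $A+A$ is measurable, $\mu(A)=\alpha$ and $\mu(A+A)=\beta$. Moreover, if $\alpha>0$, $A$ may be taken to be a finite union of open intervals.
   Context: For $A\subset\mathbb{N}$ and $t>1$ let $A(t)=|A\cap[1,t]|$; the asymptotic density of $A$ is $\mathrm{d}(A)=\lim_{t\to\infty}A(t)/t$ when this limit exists. $\mathbb{T}=\mathbb{R}/\mathbb{Z}$ is the circle with its Haar probability measure $\mu$. For subsets $A,B$ of a semigroup, $A+B=\{a+b: a\in A, b\in B\}$. *)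

theory Defs
  imports "HOL-Analysis.Analysis" "HOL-Library.Set_Algebras"
begin

definition counting :: "nat set \<Rightarrow> real \<Rightarrow> nat" where
  "counting A t = card {n \<in> A. 1 \<le> n \<and> real n \<le> t}"

definition has_density :: "nat set \<Rightarrow> real \<Rightarrow> bool" where
  "has_density A d \<longleftrightarrow> ((\<lambda>t. real (counting A t) / t) \<longlongrightarrow> d) at_top"

definition mod_int_rel :: "real \<Rightarrow> real \<Rightarrow> bool" where
  "mod_int_rel x y \<longleftrightarrow> x - y \<in> \<int>"

lemma equivp_mod_int_rel: "equivp mod_int_rel"
proof (rule equivpI)
  show "reflp mod_int_rel" by (auto simp: reflp_def mod_int_rel_def)
  show "symp mod_int_rel"
    unfolding symp_def mod_int_rel_def by (metis Ints_minus minus_diff_eq)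
  show "transp mod_int_rel"
    unfolding transp_def mod_int_rel_def
    by (metis Ints_add add.commute diff_add_cancel add_diff_eq)
qed

quotient_type circle = real / mod_int_rel
  by (rule equivp_mod_int_rel)

lift_definition to_circle :: "real \<Rightarrow> circle" is "\<lambda>x. x" .

instantiation circle :: ab_group_add
begin

lift_definition zero_circle :: circle is 0 .

lift_definition plus_circle :: "circle \<Rightarrow> circle \<Rightarrow> circle" is "(+)"
  unfolding mod_int_rel_def by (metis Ints_add add_diff_add)

lift_definition uminus_circle :: "circle \<Rightarrow> circle" is uminus
  unfolding mod_int_rel_def by (metis Ints_minus minus_diff_eq minus_diff_minus)

lift_definition minus_circle :: "circle \<Rightarrow> circle \<Rightarrow> circle" is "(-)"
  unfolding mod_int_rel_def by (metis Ints_diff diff_diff_eq2 diff_diff_eq diff_add_eq add.commute)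

instance
  by standard (transfer, simp add: mod_int_rel_def)+

end

lemma to_circle_eq_iff: "to_circle x = to_circle y \<longleftrightarrow> x - y \<in> \<int>"
  by transfer (simp add: mod_int_rel_def)

lemma to_circle_add: "to_circle (x + y) = to_circle x + to_circle y"
  by transfer (simp add: mod_int_rel_def)

lemma surj_to_circle: "surj to_circle"
proof -
  have "\<exists>x. y = to_circle x" for y
    by transfer (metis equivp_reflp equivp_mod_int_rel)
  thus ?thesis by (simp add: surj_def)
qed

instantiation circle :: topological_space
begin

definition open_circle :: "circle set \<Rightarrow> bool" where
  "open_circle U \<longleftrightarrow> open (to_circle -` U)"

instance
  by standard (auto simp: open_circle_def vimage_Union vimage_Int)

end

lemma continuous_on_to_circle: "continuous_on S to_circle"
  by (rule continuous_on_subset[of UNIV])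
     (auto simp: continuous_on_open_vimage open_circle_def)

lemma measurable_to_circle [measurable]: "to_circle \<in> borel_measurable borel"
  by (intro borel_measurable_continuous_onI continuous_on_to_circle)

text \<open>
  The Haar probability measure on the Borel sets of the circle: the image of Lebesgue measure
  on the fundamental domain \<open>[0,1)\<close>. The lemmas \<open>emeasure_haar_UNIV\<close> and
  \<open>haar_translation_invariant\<close> below confirm that it is the normalised invariant Borel measure.
\<close>

definition haar :: "circle measure" where
  "haar = distr (restrict_space lborel {0..<1}) borel to_circle"

lemma sets_haar [simp, measurable_cong]: "sets haar = sets borel"
  by (simp add: haar_def)

lemma space_haar [simp]: "space haar = UNIV"
  by (simp add: haar_def)

lemma emeasure_haar:
  assumes "A \<in> sets borel"
  shows "emeasure haar A = emeasure lborel (to_circle -` A \<inter> {0..<1})"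
proof -
  have "to_circle \<in> restrict_space lborel {0..<1} \<rightarrow>\<^sub>M borel"
    by (rule measurable_restrict_space1) simp
  with assms show ?thesis
    by (simp add: haar_def emeasure_distr space_restrict_space emeasure_restrict_space)
qed

lemma emeasure_haar_UNIV: "emeasure haar UNIV = 1"
  by (simp add: emeasure_haar)

lemma haar_translation_invariant:
  assumes A: "A \<in> sets borel"
  shows "emeasure haar ((\<lambda>x. x + c) -` A) = emeasure haar A"
proof -
  obtain r0 where r0: "c = to_circle r0" using surj_to_circle by blast
  define r where "r = frac r0"
  have c: "c = to_circle r"
    by (simp add: r0 r_def to_circle_eq_iff frac_def)
  have r: "0 \<le> r" "r < 1" by (auto simp: r_def frac_lt_1)
  define B where "B = to_circle -` A"
  have B [measurable]: "B \<in> sets borel"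
    using measurable_sets[OF measurable_to_circle A] by (simp add: B_def)
  have per: "x + 1 \<in> B \<longleftrightarrow> x \<in> B" for x
    using to_circle_eq_iff[of "x + 1" x] by (simp add: B_def)
  have shift: "emeasure lborel ((\<lambda>x. x + s) -` C) = emeasure lborel C"
    if [measurable]: "C \<in> sets borel" for C and s :: real
  proof -
    have "emeasure lborel C = emeasure (distr lborel borel ((+) s)) C"
      by (simp add: lborel_distr_plus)
    also have "\<dots> = emeasure lborel ((+) s -` C)"
      by (subst emeasure_distr) auto
    finally show ?thesis by (simp add: add.commute vimage_def)
  qed
  have pre: "to_circle -` ((\<lambda>x. x + c) -` A) = (\<lambda>x. x + r) -` B"
    by (auto simp: B_def c to_circle_add)
  have mt [measurable]: "(\<lambda>x. x + c) \<in> borel_measurable borel"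
  proof (intro borel_measurable_continuous_onI)
    have "open ((\<lambda>x. x + r) -` (to_circle -` U))" if "open U" for U
      using that unfolding open_circle_def by (rule open_vimage) (intro continuous_intros)
    moreover have "to_circle -` ((\<lambda>x. x + c) -` U) = (\<lambda>x. x + r) -` (to_circle -` U)" for U
      by (auto simp: c to_circle_add)
    ultimately show "continuous_on UNIV (\<lambda>x. x + c)"
      by (simp add: continuous_on_open_vimage open_circle_def)
  qed
  have "(\<lambda>x. x + c) -` A \<in> sets borel"
    using measurable_sets[OF mt A] by simp
  hence "emeasure haar ((\<lambda>x. x + c) -` A) = emeasure lborel ((\<lambda>x. x + r) -` B \<inter> {0..<1})"
    by (simp add: emeasure_haar pre)
  also have "(\<lambda>x. x + r) -` B \<inter> {0..<1} = (\<lambda>x. x + r) -` (B \<inter> {r..<1 + r})"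
    by auto
  also have "emeasure lborel \<dots> = emeasure lborel (B \<inter> {r..<1 + r})"
    by (rule shift) simp
  also have "B \<inter> {r..<1 + r} = (B \<inter> {r..<1}) \<union> (B \<inter> {1..<1 + r})"
    using r by auto
  also have "emeasure lborel \<dots> = emeasure lborel (B \<inter> {r..<1}) + emeasure lborel (B \<inter> {1..<1 + r})"
    by (rule plus_emeasure[symmetric]) auto
  also have "emeasure lborel (B \<inter> {1..<1 + r})
      = emeasure lborel ((\<lambda>x. x + 1) -` (B \<inter> {1..<1 + r}))"
    by (rule shift[symmetric]) simp
  also have "(\<lambda>x. x + 1) -` (B \<inter> {1..<1 + r}) = B \<inter> {0..<r}"
    using per by auto
  also have "emeasure lborel (B \<inter> {r..<1}) + emeasure lborel (B \<inter> {0..<r})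
      = emeasure lborel ((B \<inter> {r..<1}) \<union> (B \<inter> {0..<r}))"
    by (rule plus_emeasure) auto
  also have "(B \<inter> {r..<1}) \<union> (B \<inter> {0..<r}) = B \<inter> {0..<1}"
    using r by auto
  finally show ?thesis using A by (simp add: emeasure_haar B_def)
qed

text \<open>
  The bound \<open>b \<le> a + 1\<close> makes \<open>to_circle\<close> injective on the interval; the whole circle is a
  union of two such intervals.
\<close>

definition open_interval :: "circle set \<Rightarrow> bool" where
  "open_interval I \<longleftrightarrow> (\<exists>a b. a < b \<and> b \<le> a + 1 \<and> I = to_circle ` {a<..<b})"

definition finite_union_open_intervals :: "circle set \<Rightarrow> bool" where
  "finite_union_open_intervals A \<longleftrightarrow> (\<exists>F. finite F \<and> (\<forall>I\<in>F. open_interval I) \<and> A = \<Union>F)"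

end

(* Both parts use a sparse set whose sumset is nevertheless everything one could hope for.

   On the integers fix an irrational theta and put f(n) = frac(n theta). With W the thin set
   thin_basis, A consists of the n with f(n) < alpha together with the n in W with f(n) < beta/2.
   Since 2 alpha <= beta (or beta = 1), A + A stays inside {f < beta}. Conversely, for large n the set
   W contains both x+i and n-(x+i) for every i in a long run, and by equidistribution one of these
   splits n theta into two angles below beta/2; so A + A contains almost all of {f < beta}.

   On the circle, with alpha > 0, a union of short intervals in (0, beta/2) arranged like the basis
   {0,...,k-1}, {k, 2k, ...} has sumset exactly (0, beta), and its measure can be tuned to any value
   up to beta/2. For alpha = 0 the union is replaced by a comeager null set, whose sumset is full
   by Baire's theorem. *)

theory Submission
  imports Defs "HOL-Number_Theory.Cong" "HOL-Real_Asymp.Real_Asymp"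
begin

section \<open>Realization by integer sets\<close>

text \<open>For i < \<open>q\<close> the point \<open>q * (c + i * \<theta>)\<close> is within
  bounded distance of \<open>M + i * p\<close>, and the residues of i * \<open>p\<close> modulo
  \<open>q\<close> run through everything because \<open>p\<close> and \<open>q\<close> are coprime.
  So every integer r well inside the interval from \<open>q * a\<close> to \<open>q * b\<close> is
  the residue of a good index, and distinct r come from distinct indices.\<close>

lemma card_frac_rotation_block:
  fixes p q :: int and \<theta> a b c :: real
  assumes "q > 0" "coprime p q" and app: "\<bar>\<theta> - p / q\<bar> < 1 / (of_int q)\<^sup>2"
    and ab: "0 \<le> a" "b \<le> 1"
  shows "real (card {i \<in> {..<nat q}. frac (c + real i * \<theta>) \<in> {a..<b}}) \<ge> of_int q * (b - a) - 4"
proof -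
  define M where "M = \<lfloor>q * c\<rfloor>"
  \<comment> \<open>The margins, 1 on the left and 2 on the right, absorb the fractional part
    \<open>f\<close> in [0,1) and the approximation error \<open>e\<close> in (-1,1) introduced
    below; they and the rounding of the endpoints cost the 4.\<close>
  define R where "R = {\<lceil>q * a + 1\<rceil>..\<lfloor>q * b - 2\<rfloor>}"
  define S where "S = {i \<in> {..<nat q}. frac (c + real i * \<theta>) \<in> {a..<b}}"
  have "R \<subseteq> (\<lambda>i. (M + int i * p) mod q) ` S"
  proof
    fix r assume "r \<in> R"
    hence r: "q * a + 1 \<le> r" "r \<le> q * b - 2"
      unfolding R_def atLeastAtMost_iff ceiling_le_iff le_floor_iff by blast+
    have "0 \<le> of_int q * a" "of_int q * b \<le> of_int q * 1" using assms by (auto intro!: mult_left_mono)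
    hence "0 \<le> real_of_int r" "real_of_int r < of_int q" using r by auto
    hence r0: "0 \<le> r" "r < q" by auto
    obtain p' where p': "[p * p' = 1] (mod q)" using cong_solve_coprime_int[OF \<open>coprime p q\<close>] by blast
    \<comment> \<open>With \<open>p'\<close> the inverse of \<open>p\<close> modulo
      \<open>q\<close>, this index solves \<open>M + i * p\<close> congruent to
      \<open>r\<close>.\<close>
    define i where "i = nat ((p' * (r - M)) mod q)"
    have i: "int i = (p' * (r - M)) mod q" "i < nat q" using \<open>q > 0\<close> by (auto simp: i_def nat_less_iff)
    have "[int i * p = (p' * (r - M)) * p] (mod q)" unfolding i by (intro cong_mult) auto
    also have "(p' * (r - M)) * p = (p * p') * (r - M)" by (simp add: mult_ac)
    also have "[(p * p') * (r - M) = 1 * (r - M)] (mod q)" using p' by (intro cong_mult) auto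
    finally have "[M + int i * p = M + (r - M)] (mod q)" by (intro cong_add) auto
    hence mod: "(M + int i * p) mod q = r" using r0 by (simp add: cong_def)
    define t where "t = (M + int i * p) div q"
    have t: "M + int i * p = q * t + r" using mod by (metis mult_div_mod_eq t_def)
    define e where "e = of_int q * (real i * (\<theta> - p / q))"
    have "\<bar>e\<bar> < 1"
    proof -
      have "\<bar>e\<bar> = of_int q * real i * \<bar>\<theta> - p / q\<bar>" using \<open>q > 0\<close> by (simp add: e_def abs_mult)
      also have "\<dots> \<le> of_int q * of_int q * \<bar>\<theta> - p / q\<bar>" 
        using i(2) \<open>q > 0\<close> by (intro mult_right_mono mult_left_mono) linarith+
      also have "\<dots> < of_int q * of_int q * (1 / (of_int q)\<^sup>2)" using \<open>q > 0\<close> app by (intro mult_strict_left_mono) auto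
      also have "\<dots> = 1" using \<open>q > 0\<close> by (simp add: power2_eq_square)
      finally show ?thesis .
    qed
    define f where "f = frac (q * c)"
    have f: "0 \<le> f" "f < 1" by (auto simp: f_def frac_lt_1)
    have tr: "real_of_int M + i * p = q * t + r" using t by (metis of_int_add of_int_mult of_int_of_nat_eq)
    have qx: "q * (c + real i * \<theta>) = q * t + (r + f + e)"
    proof -
      have "q * c = M + f" by (simp add: M_def f_def frac_def)
      moreover have "q * (real i * \<theta>) = i * p + e" using \<open>q > 0\<close> by (simp add: e_def field_simps)
      ultimately show ?thesis using tr by (simp add: algebra_simps)
    qed
    define y where "y = c + real i * \<theta> - t"
    have y: "q * y = r + f + e" using qx by (simp add: y_def algebra_simps)
    have "q * a \<le> q * y" "q * y < q * b" unfolding y using r f \<open>\<bar>e\<bar> < 1\<close> by auto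
    hence ya: "a \<le> y" "y < b" using \<open>q > 0\<close> by auto
    have "frac (c + real i * \<theta>) = y"
      unfolding frac_unique_iff using ya ab by (auto simp: y_def)
    hence "i \<in> S" using ya i by (auto simp: S_def)
    thus "r \<in> (\<lambda>i. (M + int i * p) mod q) ` S" using mod by blast
  qed
  hence "card R \<le> card S" by (intro surj_card_le) (auto simp: S_def)
  moreover have "real (card R) \<ge> of_int q * (b - a) - 4"
  proof -
    have "real (card R) \<ge> of_int (\<lfloor>q * b - 2\<rfloor> - \<lceil>q * a + 1\<rceil> + 1)" by (simp add: R_def)
    moreover have "of_int \<lfloor>q * b - 2\<rfloor> > q * b - 3" "of_int \<lceil>q * a + 1\<rceil> < q * a + 2" by linarith+
    ultimately show ?thesis by (simp add: algebra_simps)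
  qed
  ultimately show ?thesis unfolding S_def by linarith
qed

text \<open>An irrational number has infinitely many approximations within 1/q^2, so
  \<open>q\<close> can be taken beyond any \<open>K\<close>. The same \<open>q\<close> serves every
  start \<open>c\<close> and every interval; this uniformity is needed when start and interval
  depend on the integer to be represented.\<close>

lemma frac_rotation_blocks:
  fixes \<theta> :: real
  assumes "\<theta> \<notin> \<rat>"
  obtains q where "q > K" "\<And>a b c. 0 \<le> a \<Longrightarrow> b \<le> 1 \<Longrightarrow>
    real (card {i \<in> {..<q}. frac (c + real i * \<theta>) \<in> {a..<b}}) \<ge> real q * (b - a) - 4"
proof -
  obtain p q where pq: "(p, q) \<in> approx_set \<theta>" "q > int K"
    using infinite_approx_set rational_iff_finite_approx_set assms by meson
  show thesis
  proof (rule that[of "nat q"])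
    show "nat q > K" using pq by auto
    show "real (card {i \<in> {..<nat q}. frac (c + real i * \<theta>) \<in> {a..<b}}) \<ge> real (nat q) * (b - a) - 4" 
      if "0 \<le> a" "b \<le> 1" for a b c
      using card_frac_rotation_block[of q p \<theta> a b c] pq that by (auto simp: approx_set_def)
  qed
qed

text \<open>Cut {1..N} into blocks of length \<open>q\<close>: each full block loses at most 4
  points, a proportion below \<open>\<epsilon> / 2\<close>, and the incomplete last block costs at
  most \<open>q\<close>. Lower bounds are all that is needed, since the complementary interval
  supplies the upper ones.\<close>

lemma frac_rotation_count:
  fixes \<theta> :: real
  assumes "\<theta> \<notin> \<rat>" "0 \<le> a" "b \<le> 1" "\<epsilon> > 0"
  shows "\<forall>\<^sub>F N in sequentially.
    real (card {n \<in> {1..N}. frac (real n * \<theta>) \<in> {a..<b}}) \<ge> (b - a - \<epsilon>) * real N"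
proof (cases "a \<le> b")
  case False
  hence "(b - a - \<epsilon>) * real N \<le> 0" for N using assms by (intro mult_nonpos_nonneg) auto
  thus ?thesis by (intro always_eventually allI order_trans[OF _ of_nat_0_le_iff])
next
  case True
  obtain q where q: "q > nat \<lceil>8 / \<epsilon>\<rceil>" and block: "\<And>c. 
    real (card {i \<in> {..<q}. frac (c + real i * \<theta>) \<in> {a..<b}}) \<ge> real q * (b - a) - 4"
    by (rule frac_rotation_blocks[OF assms(1), of "nat \<lceil>8 / \<epsilon>\<rceil>"]) (use assms(2,3) in blast)
  have "8 / \<epsilon> < real q" using q by linarith
  hence "q > 0" using q by auto
  hence q4: "4 / real q < \<epsilon> / 2" using \<open>8 / \<epsilon> < real q\<close> assms by (simp add: field_simps)
  define X where "X N = {n \<in> {1..N}. frac (real n * \<theta>) \<in> {a..<b}}" for N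
  have Xq: "real (card (X (N + q))) \<ge> real (card (X N)) + (real q * (b - a) - 4)" for N
  proof -
    define Y where "Y = (\<lambda>i. N + 1 + i) ` {i \<in> {..<q}. frac ((real N + 1) * \<theta> + real i * \<theta>) \<in> {a..<b}}"
    have "X N \<union> Y \<subseteq> X (N + q)"
      by (auto simp: X_def Y_def algebra_simps)
    hence "card (X N \<union> Y) \<le> card (X (N + q))" by (intro card_mono) (auto simp: X_def)
    moreover have "card (X N \<union> Y) = card (X N) + card Y" by (intro card_Un_disjoint) (auto simp: X_def Y_def)
    moreover have "card Y = card {i \<in> {..<q}. frac ((real N + 1) * \<theta> + real i * \<theta>) \<in> {a..<b}}"
      unfolding Y_def by (intro card_image) (auto simp: inj_on_def)
    ultimately show ?thesis using block[of "(real N + 1) * \<theta>"] by simp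
  qed
  have Xm: "real (card (X (m * q))) \<ge> real m * (real q * (b - a) - 4)" for m
  proof (induction m)
    case (Suc m)
    thus ?case using Xq[of "m * q"] by (simp add: algebra_simps)
  qed auto
  have X: "real (card (X N)) \<ge> (b - a - \<epsilon> / 2) * real N - q" for N
  proof -
    define m where "m = N div q"
    have "N < (m + 1) * q" using \<open>q > 0\<close> by (metis dividend_less_div_times m_def mult.commute add.commute mult_Suc_right Suc_eq_plus1)
    hence "real N < real ((m + 1) * q)" using of_nat_less_iff by blast
    hence m: "real N < real m * real q + real q" by (simp add: algebra_simps)
    have "m * q \<le> N" by (simp add: m_def)
    hence "real (m * q) \<le> real N" using of_nat_le_iff by blast
    hence m': "real m * real q \<le> real N" by simp
    have "card (X (m * q)) \<le> card (X N)" using \<open>m * q \<le> N\<close> by (intro card_mono) (auto simp: X_def)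
    hence "real (card (X N)) \<ge> real m * (real q * (b - a) - 4)" using Xm[of m] by linarith
    moreover have "real m * 4 \<le> (\<epsilon> / 2) * real N"
    proof -
      have "real m * 4 = (real m * real q) * (4 / real q)" using \<open>q > 0\<close> by simp
      also have "\<dots> \<le> real N * (\<epsilon> / 2)" using m' q4 by (intro mult_mono) auto
      finally show ?thesis by (simp add: mult_ac)
    qed
    moreover have "real m * real q * (b - a) \<ge> real N * (b - a) - q"
    proof -
      have "(real N - real m * real q) * (b - a) \<le> real q * 1" 
        using m m' True assms by (intro mult_mono) auto
      thus ?thesis by (simp add: algebra_simps)
    qed
    ultimately show ?thesis by (simp add: algebra_simps)
  qed
  have "\<forall>\<^sub>F N in sequentially. real N \<ge> 2 * q / \<epsilon>"
    using eventually_ge_at_top[of "nat \<lceil>2 * q / \<epsilon>\<rceil>"] by eventually_elim linarith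
  thus ?thesis
  proof eventually_elim
    case (elim N)
    hence "real q \<le> \<epsilon> / 2 * real N" using \<open>\<epsilon> > 0\<close> by (simp add: field_simps)
    thus ?case using X[of N] unfolding X_def by (simp add: algebra_simps)
  qed
qed

section \<open>A criterion for asymptotic density\<close>

text \<open>A lower count for the complement is an upper count for \<open>A\<close>, so both
  hypotheses have the shape delivered by \<open>frac_rotation_count\<close>.\<close>

lemma has_densityI:
  assumes lower: "\<And>\<epsilon>. \<epsilon> > 0 \<Longrightarrow> \<forall>\<^sub>F N in sequentially. real (card (A \<inter> {1..N})) \<ge> (d - \<epsilon>) * real N"
    and upper: "\<And>\<epsilon>. \<epsilon> > 0 \<Longrightarrow> \<forall>\<^sub>F N in sequentially. real (card ({1..N} - A)) \<ge> (1 - d - \<epsilon>) * real N"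
  shows "has_density A d"
proof -
  define c where "c N = card (A \<inter> {1..N})" for N
  have lim: "(\<lambda>N. real (c N) / real N) \<longlonglongrightarrow> d"
  proof (rule LIMSEQ_I)
    fix \<epsilon> :: real assume "\<epsilon> > 0"
    hence "\<epsilon> / 2 > 0" by simp
    from lower[OF this] upper[OF this] eventually_gt_at_top[of 0]
    have "\<forall>\<^sub>F N in sequentially. norm (real (c N) / real N - d) < \<epsilon>"
    proof eventually_elim
      case (elim N)
      have "card (A \<inter> {1..N}) + card ({1..N} - A) = card {1..N}"
        by (metis card_Int_Diff finite_atLeastAtMost inf_commute)
      hence eq: "real (card ({1..N} - A)) = real N - real (c N)" by (simp add: c_def)
      have "(d - \<epsilon> / 2) \<le> real (c N) / real N" "real (c N) / real N \<le> d + \<epsilon> / 2"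
        using elim eq by (auto simp: c_def field_simps)
      thus ?case using \<open>\<epsilon> > 0\<close> by (simp add: abs_less_iff)
    qed
    thus "\<exists>N0. \<forall>N\<ge>N0. norm (real (c N) / real N - d) < \<epsilon>" by (simp add: eventually_sequentially)
  qed
  \<comment> \<open>Passage from integers to real t: \<open>counting A t\<close> depends only on the
    floor of t, and floor(t)/t tends to 1.\<close>
  have fl: "filterlim (\<lambda>t::real. nat \<lfloor>t\<rfloor>) sequentially at_top"
    by (rule filterlim_compose[OF filterlim_nat_sequentially filterlim_floor_sequentially])
  have quot: "((\<lambda>t::real. real_of_int \<lfloor>t\<rfloor> / t) \<longlongrightarrow> 1) at_top" by real_asymp
  have "((\<lambda>t. real (c (nat \<lfloor>t\<rfloor>)) / real (nat \<lfloor>t\<rfloor>) * (real_of_int \<lfloor>t\<rfloor> / t)) \<longlongrightarrow> d * 1) at_top"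
    by (intro tendsto_mult filterlim_compose[OF lim fl] quot)
  moreover have "\<forall>\<^sub>F t in at_top. real (c (nat \<lfloor>t\<rfloor>)) / real (nat \<lfloor>t\<rfloor>) * (real_of_int \<lfloor>t\<rfloor> / t)
      = real (counting A t) / t"
    using eventually_ge_at_top[of 1]
  proof eventually_elim
    case (elim t)
    have "{n \<in> A. 1 \<le> n \<and> real n \<le> t} = A \<inter> {1..nat \<lfloor>t\<rfloor>}"
      using elim by (auto simp: le_nat_floor nat_le_iff le_floor_iff) linarith
    hence "counting A t = c (nat \<lfloor>t\<rfloor>)" by (simp add: counting_def c_def)
    moreover have "\<lfloor>t\<rfloor> \<noteq> 0" "\<lfloor>t\<rfloor> \<ge> 0" using elim by linarith+
    ultimately show ?case by simp
  qed
  ultimately show ?thesis unfolding has_density_def by (auto elim: Lim_transform_eventually)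
qed

section \<open>A thin set with long runs of representations\<close>

text \<open>
  Since both a full window \<open>[4^k, 4^k + 2\<cdot>2^k]\<close> and the blocks of length \<open>k\<close> at the multiples of
  \<open>2^k\<close> lie above \<open>4^k\<close>, the windows of all scales together still have density \<open>0\<close>; windows
  starting at \<open>0\<close> would fill up everything.
\<close>

definition thin_basis :: "nat set" where
  "thin_basis = {n. \<exists>k. 4 ^ k \<le> n \<and> (n \<le> 4 ^ k + 2 * 2 ^ k \<or> n \<le> 16 * 4 ^ k \<and> n mod 2 ^ k < k)}"

text \<open>Scale k starts at 4^k, so below 4^(K+1) only the scales k \<le> \<open>K\<close> matter.
  Each contributes a window of about 2 * 2^k numbers, together with k residues at each of about 16 *
  2^k multiples of 2^k. In total this is of order sqrt(N) (log N)^2 when N is comparable to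
  4^K.\<close>

lemma card_thin_basis_le:
  assumes "N < 4 ^ Suc K"
  shows "card (thin_basis \<inter> {1..N}) \<le> 20 * (K + 1)\<^sup>2 * 2 ^ K"
proof -
  define F where "F k = {(4::nat) ^ k..4 ^ k + 2 * 2 ^ k}" for k :: nat
  \<comment> \<open>The lower bound 4^k of the definition is dropped here; the overcount does not
    affect the order of magnitude.\<close>
  define G where "G k = {n. n \<le> 16 * (4::nat) ^ k \<and> n mod 2 ^ k < k}" for k
  have four: "(4::nat) ^ k = 2 ^ k * 2 ^ k" for k :: nat
    by (metis numeral_Bit0 power_mult_distrib mult_2 numeral_times_numeral semiring_norm(11) mult_2_right)
  have G: "G k \<subseteq> (\<lambda>(j, r). j * 2 ^ k + r) ` ({..16 * 2 ^ k} \<times> {..<k})" for k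
  proof
    fix n assume n: "n \<in> G k"
    have "n div 2 ^ k \<le> 16 * 4 ^ k div 2 ^ k" using n by (intro div_le_mono) (auto simp: G_def)
    also have "\<dots> = 16 * 2 ^ k" by (simp add: four)
    finally show "n \<in> (\<lambda>(j, r). j * 2 ^ k + r) ` ({..16 * 2 ^ k} \<times> {..<k})"
      using n by (intro image_eqI[of _ _ "(n div 2 ^ k, n mod 2 ^ k)"]) (auto simp: G_def div_mult_mod_eq)
  qed
  have finG: "finite (G k)" for k using finite_subset[OF G] by auto
  have "card (G k) \<le> (16 * 2 ^ k + 1) * k" for k
  proof -
    have "card (G k) \<le> card ({..16 * (2::nat) ^ k} \<times> {..<k})" by (intro surj_card_le[OF _ G]) auto
    thus ?thesis by simp
  qed
  moreover have "(16 * 2 ^ k + 1) * k \<le> (17 * 2 ^ k) * k" for k :: nat by (intro mult_right_mono) auto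
  ultimately have cG: "card (G k) \<le> (17 * 2 ^ k) * k" for k using le_trans by blast
  have cF: "card (F k) \<le> 3 * 2 ^ k" for k by (simp add: F_def)
  have FG: "card (F k \<union> G k) \<le> 20 * (K + 1) * 2 ^ K" if "k \<le> K" for k
  proof -
    have "card (F k \<union> G k) \<le> 3 * 2 ^ k + (17 * 2 ^ k) * k"
      using card_Un_le[of "F k" "G k"] cF[of k] cG[of k] by linarith
    also have "\<dots> \<le> 20 * (k + 1) * 2 ^ k" by (simp add: algebra_simps)
    also have "\<dots> \<le> 20 * (K + 1) * 2 ^ K" using that by (intro mult_mono power_increasing) auto
    finally show ?thesis .
  qed
  have "thin_basis \<inter> {1..N} \<subseteq> (\<Union>k\<in>{..K}. F k \<union> G k)"
  proof
    fix n assume n: "n \<in> thin_basis \<inter> {1..N}"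
    then obtain k where k: "4 ^ k \<le> n" "n \<le> 4 ^ k + 2 * 2 ^ k \<or> n \<le> 16 * 4 ^ k \<and> n mod 2 ^ k < k"
      by (auto simp: thin_basis_def)
    have "(4::nat) ^ k < 4 ^ Suc K" using k n assms by (auto intro: le_less_trans)
    hence "k < Suc K" by (rule power_less_imp_less_exp[rotated]) simp
    thus "n \<in> (\<Union>k\<in>{..K}. F k \<union> G k)" using k by (auto simp: F_def G_def intro!: bexI[of _ k])
  qed
  hence "card (thin_basis \<inter> {1..N}) \<le> card (\<Union>k\<in>{..K}. F k \<union> G k)"
    by (intro card_mono) (auto simp: finG F_def)
  also have "\<dots> \<le> (\<Sum>k\<in>{..K}. card (F k \<union> G k))" by (intro card_UN_le) auto
  also have "\<dots> \<le> (\<Sum>k\<in>{..K}. 20 * (K + 1) * 2 ^ K)" by (intro sum_mono FG) auto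
  also have "\<dots> = 20 * (K + 1)\<^sup>2 * 2 ^ K" by (simp add: power2_eq_square algebra_simps)
  finally show ?thesis .
qed

lemma thin_basis_null:
  assumes "\<epsilon> > 0"
  shows "\<forall>\<^sub>F N in sequentially. real (card (thin_basis \<inter> {1..N})) \<le> \<epsilon> * real N"
proof -
  have "((\<lambda>K::nat. 20 * (real K + 1)\<^sup>2 * 2 ^ K / 4 ^ K) \<longlongrightarrow> 0) at_top" by real_asymp
  hence "\<forall>\<^sub>F K in sequentially. 20 * (real K + 1)\<^sup>2 * 2 ^ K / 4 ^ K < \<epsilon>"
    using assms by (rule order_tendstoD)
  then obtain K0 where K0: "\<And>K. K \<ge> K0 \<Longrightarrow> 20 * (real K + 1)\<^sup>2 * 2 ^ K / 4 ^ K < \<epsilon>"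
    by (auto simp: eventually_sequentially)
  show ?thesis using eventually_ge_at_top[of "4 ^ K0"]
  proof eventually_elim
    case (elim N)
    have "N \<ge> 1" using elim by (meson one_le_numeral one_le_power order_trans)
    then obtain K where K: "4 ^ K \<le> N" "N < 4 ^ (K + 1)" using ex_power_ivl1[of 4 N] by auto
    have "(4::nat) ^ K0 < 4 ^ (K + 1)" using elim K by linarith
    hence "K \<ge> K0" using power_less_imp_less_exp[of "4::nat" K0 "K + 1"] by simp
    have "real (card (thin_basis \<inter> {1..N})) \<le> real (20 * (K + 1)\<^sup>2 * 2 ^ K)"
      using card_thin_basis_le[of N K] K by (intro of_nat_mono) simp
    also have "\<dots> = 20 * (real K + 1)\<^sup>2 * 2 ^ K" by (simp add: add_ac)
    also have "\<dots> \<le> \<epsilon> * 4 ^ K" using K0[OF \<open>K \<ge> K0\<close>] by (simp add: field_simps)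
    also have "\<dots> \<le> \<epsilon> * real N" 
    proof -
      have "real (4 ^ K) \<le> real N" using K(1) of_nat_le_iff by blast
      thus ?thesis using assms by simp
    qed
    finally show ?case .
  qed
qed

text \<open>Take \<open>x\<close> to be a multiple of 2^k just below n - 4^k - 2^k. For i < k the
  number x + i has residue i modulo 2^k, hence is of the second type at scale k, while n - (x + i)
  falls into the window at 4^k.\<close>

lemma thin_basis_block:
  assumes n: "4 ^ Suc k \<le> n" "n < 4 ^ Suc (Suc k)"
  obtains x where "\<And>i. i < k \<Longrightarrow> x + i \<le> n \<and> x + i \<in> thin_basis \<and> n - (x + i) \<in> thin_basis"
proof -
  define P where "P = (2::nat) ^ k"
  have four: "(4::nat) ^ k = P * P"
    by (simp add: P_def flip: power_mult_distrib)
  have "P \<ge> 1" "k < P" by (simp_all add: P_def)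
  have n1: "4 * (P * P) \<le> n" "n < 16 * (P * P)" using n by (auto simp: four)
  have PP: "P \<le> P * P" using \<open>P \<ge> 1\<close> by simp
  \<comment> \<open>Subtracting the extra \<open>P\<close> leaves room for rounding down to a
    multiple of \<open>P\<close> and for the shift by i < \<open>P\<close>: the complement
    \<open>n - (x + i)\<close> stays between \<open>P * P\<close> and
    \<open>P * P + 2 * P\<close>.\<close>
  define m where "m = n - P * P - P"
  have m: "n = m + P * P + P" using n1 PP unfolding m_def by linarith
  define x where "x = m div P * P"
  have x: "x \<le> m" "m < x + P" using \<open>P \<ge> 1\<close> dividend_less_div_times[of P m] by (auto simp: x_def add.commute)
  show thesis
  proof (rule that)
    fix i assume i: "i < k"
    have le: "x + i \<le> n" using x m i \<open>k < P\<close> by linarith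
    have "(x + i) mod P = i" using i \<open>k < P\<close> by (simp add: x_def)
    moreover have "P * P \<le> x + i" using x m n1 PP by linarith
    ultimately have "x + i \<in> thin_basis"
      using i n1 le unfolding thin_basis_def by (auto simp: four P_def[symmetric] intro!: exI[of _ k])
    moreover have "P * P \<le> n - (x + i)" "n - (x + i) \<le> P * P + 2 * P"
      using x m i \<open>k < P\<close> by linarith+
    hence "n - (x + i) \<in> thin_basis"
      unfolding thin_basis_def by (auto simp: four P_def[symmetric] intro!: exI[of _ k])
    ultimately show "x + i \<le> n \<and> x + i \<in> thin_basis \<and> n - (x + i) \<in> thin_basis" using le by blast
  qed
qed

section \<open>The integer realization\<close>

text \<open>A large n has a run of at least \<open>q\<close> consecutive y with both y and n - y in
  \<open>thin_basis\<close>. Along the run y\<theta> is a rotation orbit, so it enters any interval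
  of length \<open>\<eta> / 2\<close>, in particular one that forces both y and n - y into
  \<open>T\<close>.\<close>

lemma thin_Bohr_sumset:
  fixes \<theta> :: real
  assumes "\<theta> \<notin> \<rat>" "b \<le> 1" "\<eta> > 0"
  defines "T \<equiv> {n \<in> thin_basis. frac (real n * \<theta>) < b / 2}"
  shows "\<exists>N. \<forall>n\<ge>N. frac (real n * \<theta>) \<in> {\<eta>..<b - \<eta>} \<longrightarrow> n \<in> T + T"
proof -
  obtain q where q: "q > nat \<lceil>8 / \<eta>\<rceil>" and block: "\<And>u v c. 0 \<le> u \<Longrightarrow> v \<le> 1 \<Longrightarrow>
    real (card {i \<in> {..<q}. frac (c + real i * \<theta>) \<in> {u..<v}}) \<ge> real q * (v - u) - 4"
    by (rule frac_rotation_blocks[OF assms(1), of "nat \<lceil>8 / \<eta>\<rceil>"]) blast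
  have "8 / \<eta> < real q" using q by linarith
  hence q4: "real q * (\<eta> / 2) > 4" using \<open>\<eta> > 0\<close> by (simp add: field_simps)
  have "n \<in> T + T" if n: "n \<ge> 4 ^ Suc q" and z: "frac (real n * \<theta>) \<in> {\<eta>..<b - \<eta>}" for n
  proof -
    define z where "z = frac (real n * \<theta>)"
    have "n \<ge> 1" using n by (meson one_le_numeral one_le_power order_trans)
    then obtain k' where k': "4 ^ k' \<le> n" "n < 4 ^ (k' + 1)" using ex_power_ivl1[of 4 n] by auto
    have "(4::nat) ^ Suc q < 4 ^ (k' + 1)" using n k' by linarith
    hence "Suc q \<le> k'" using power_less_imp_less_exp[of "4::nat" "Suc q" "k' + 1"] by simp
    then obtain k where k: "k' = Suc k" "q \<le> k" by (cases k') auto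
    obtain x where x: "\<And>i. i < k \<Longrightarrow> x + i \<le> n \<and> x + i \<in> thin_basis \<and> n - (x + i) \<in> thin_basis"
      using thin_basis_block[of k n] k' k by auto
    \<comment> \<open>The window is chosen so that a fractional part w in [\<open>u\<close>,
      \<open>v\<close>) satisfies w < \<open>b / 2\<close> and 0 < \<open>z - w\<close> <
      \<open>b / 2\<close>. Trimming \<open>z\<close> by \<open>\<eta>\<close> at both ends keeps
      its length at least \<open>\<eta> / 2\<close>.\<close>
    define u where "u = max 0 (z - b / 2 + \<eta> / 2)"
    define v where "v = min z (b / 2)"
    have uv: "0 \<le> u" "v \<le> 1" "\<eta> / 2 \<le> v - u"
      using z \<open>\<eta> > 0\<close> \<open>b \<le> 1\<close> by (auto simp: u_def v_def z_def[symmetric] min_def max_def)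
    have "real q * (\<eta> / 2) \<le> real q * (v - u)" using uv by (intro mult_left_mono) auto
    hence "real (card {i \<in> {..<q}. frac (real x * \<theta> + real i * \<theta>) \<in> {u..<v}}) > 0"
      using block[OF uv(1,2), of "real x * \<theta>"] q4 by linarith
    hence "{i \<in> {..<q}. frac (real x * \<theta> + real i * \<theta>) \<in> {u..<v}} \<noteq> {}" by (metis card.empty less_irrefl of_nat_0)
    then obtain i where i: "i < q" "frac (real x * \<theta> + real i * \<theta>) \<in> {u..<v}" by blast
    define y where "y = x + i"
    have y: "y \<le> n" "y \<in> thin_basis" "n - y \<in> thin_basis" using x[of i] i k by (auto simp: y_def)
    have fy: "u \<le> frac (real y * \<theta>)" "frac (real y * \<theta>) < v" using i by (auto simp: y_def algebra_simps)
    \<comment> \<open>No borrow occurs in the subtraction, because the fractional part at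
      \<open>y\<close> is below \<open>v\<close> \<le> \<open>z\<close>.\<close>
    have "frac (real (n - y) * \<theta>) = z - frac (real y * \<theta>)"
    proof -
      have "real (n - y) * \<theta> - (z - frac (real y * \<theta>)) = of_int (\<lfloor>real n * \<theta>\<rfloor> - \<lfloor>real y * \<theta>\<rfloor>)"
        using y by (simp add: z_def frac_def of_nat_diff algebra_simps)
      moreover have "z - frac (real y * \<theta>) < 1"
        using frac_lt_1[of "real n * \<theta>"] frac_ge_0[of "real y * \<theta>"] unfolding z_def by linarith
      ultimately show ?thesis unfolding frac_unique_iff using fy
        by (auto simp: z_def[symmetric] u_def v_def)
    qed
    hence "y \<in> T" "n - y \<in> T" using fy y \<open>\<eta> > 0\<close> by (auto simp: T_def u_def v_def)
    thus ?thesis using y(1) set_plus_intro[of y T "n - y" T] by simp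
  qed
  thus ?thesis by blast
qed

text \<open>The Bohr piece alone gives \<open>A\<close> its density, as \<open>T\<close> has density
  0; the lower bound for \<open>A + A\<close> comes from \<open>T + T\<close> alone.\<close>

lemma density_sumset_realization:
  fixes \<alpha> \<beta> :: real
  assumes "0 \<le> \<alpha>" "\<alpha> \<le> 1" "0 \<le> \<beta>" "\<beta> \<le> 1" and ab: "2 * \<alpha> \<le> \<beta> \<or> \<beta> = 1"
  obtains A :: "nat set" where "A \<subseteq> {1..}" "has_density A \<alpha>" "has_density (A + A) \<beta>"
proof -
  obtain \<theta> :: real where \<theta>: "\<theta> \<notin> \<rat>"
    using uncountable_UNIV_real countable_rat by (metis UNIV_eq_I)
  define f where "f n = frac (real n * \<theta>)" for n
  have f1: "f n < 1" for n by (simp add: f_def frac_lt_1)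
  define T where "T = {n \<in> thin_basis. f n < \<beta> / 2}"
  define A where "A = {n. 1 \<le> n \<and> f n < \<alpha>} \<union> T"
  have pos: "n \<ge> 1" if "n \<in> thin_basis" for n
    using that order_trans[OF one_le_power[OF one_le_numeral]] unfolding thin_basis_def by blast
  show thesis
  proof (rule that[of A])
    show "A \<subseteq> {1..}" using pos by (auto simp: A_def T_def)
    show "has_density A \<alpha>"
    proof (rule has_densityI)
      fix \<epsilon> :: real assume "\<epsilon> > 0"
      from frac_rotation_count[OF \<theta> order_refl \<open>\<alpha> \<le> 1\<close> \<open>\<epsilon> > 0\<close>]
      show "\<forall>\<^sub>F N in sequentially. real (card (A \<inter> {1..N})) \<ge> (\<alpha> - \<epsilon>) * real N"
      proof eventually_elim
        case (elim N)
        have "card {n \<in> {1..N}. frac (real n * \<theta>) \<in> {0..<\<alpha>}} \<le> card (A \<inter> {1..N})"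
          by (intro card_mono) (auto simp: A_def f_def)
        with elim show ?case by simp
      qed
      have "\<epsilon> / 2 > 0" using \<open>\<epsilon> > 0\<close> by simp
      from frac_rotation_count[OF \<theta> \<open>0 \<le> \<alpha>\<close> order_refl this] thin_basis_null[OF this]
      show "\<forall>\<^sub>F N in sequentially. real (card ({1..N} - A)) \<ge> (1 - \<alpha> - \<epsilon>) * real N"
      proof eventually_elim
        case (elim N)
        have "card {n \<in> {1..N}. frac (real n * \<theta>) \<in> {\<alpha>..<1}} \<le> card (({1..N} - A) \<union> (thin_basis \<inter> {1..N}))"
          by (intro card_mono) (auto simp: A_def f_def T_def)
        also have "\<dots> \<le> card ({1..N} - A) + card (thin_basis \<inter> {1..N})" by (rule card_Un_le)
        finally show ?case using elim by (simp add: algebra_simps)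
      qed
    qed
    show "has_density (A + A) \<beta>"
    proof (rule has_densityI)
      fix \<epsilon> :: real assume "\<epsilon> > 0"
      \<comment> \<open>Four losses of size \<eta>: two from trimming the interval, one from the
        counting error, one from the first \<open>N0\<close> integers.\<close>
      define \<eta> where "\<eta> = \<epsilon> / 4"
      have "\<eta> > 0" using \<open>\<epsilon> > 0\<close> by (simp add: \<eta>_def)
      obtain N0 where N0: "\<And>n. n \<ge> N0 \<Longrightarrow> f n \<in> {\<eta>..<\<beta> - \<eta>} \<Longrightarrow> n \<in> T + T"
        using thin_Bohr_sumset[OF \<theta> \<open>\<beta> \<le> 1\<close> \<open>\<eta> > 0\<close>] unfolding T_def f_def by blast
      have le: "0 \<le> \<eta>" "\<beta> - \<eta> \<le> 1" using \<open>\<eta> > 0\<close> assms by auto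
      have "\<forall>\<^sub>F N in sequentially. real N0 \<le> \<eta> * real N"
        using eventually_ge_at_top[of "nat \<lceil>N0 / \<eta>\<rceil>"]
      proof eventually_elim
        case (elim N)
        hence "N0 / \<eta> \<le> real N" by linarith
        thus ?case using \<open>\<eta> > 0\<close> by (simp add: field_simps)
      qed
      with frac_rotation_count[OF \<theta> le \<open>\<eta> > 0\<close>]
      show "\<forall>\<^sub>F N in sequentially. real (card ((A + A) \<inter> {1..N})) \<ge> (\<beta> - \<epsilon>) * real N"
      proof eventually_elim
        case (elim N)
        have "T + T \<subseteq> A + A" by (intro set_plus_mono2) (auto simp: A_def)
        hence "card {n \<in> {1..N}. frac (real n * \<theta>) \<in> {\<eta>..<\<beta> - \<eta>}} \<le> card (((A + A) \<inter> {1..N}) \<union> {..<N0})"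
          using N0 by (intro card_mono) (auto simp: f_def not_less)
        also have "\<dots> \<le> card ((A + A) \<inter> {1..N}) + N0" using card_Un_le[of _ "{..<N0}"] by simp
        finally show ?case using elim by (simp add: algebra_simps \<eta>_def)
      qed
      \<comment> \<open>If \<beta> is not 1, then 2\<alpha> \<le> \<beta>, so both pieces of
        \<open>A\<close> satisfy \<open>f\<close> < \<beta>/2, and the sum of two such values stays
        below 1 and does not wrap around.\<close>
      have "f n < \<beta>" if "n \<in> A + A" for n
      proof (cases "\<beta> = 1")
        case True
        thus ?thesis using f1 by simp
      next
        case False
        from that obtain a b where ab': "n = a + b" "a \<in> A" "b \<in> A" by (auto elim: set_plus_elim)
        have "f a < \<beta> / 2" "f b < \<beta> / 2" using ab False ab' by (auto simp: A_def T_def)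
        hence "frac (real a * \<theta>) + frac (real b * \<theta>) < \<beta>" by (simp add: f_def)
        moreover from this have "frac (real a * \<theta> + real b * \<theta>) = frac (real a * \<theta>) + frac (real b * \<theta>)"
          using \<open>\<beta> \<le> 1\<close> by (simp add: frac_add)
        ultimately show ?thesis by (simp add: f_def ab' algebra_simps)
      qed
      hence sub: "{n \<in> {1..N}. frac (real n * \<theta>) \<in> {\<beta>..<1}} \<subseteq> {1..N} - (A + A)" for N
        by (force simp: f_def)
      from frac_rotation_count[OF \<theta> \<open>0 \<le> \<beta>\<close> order_refl \<open>\<epsilon> > 0\<close>]
      show "\<forall>\<^sub>F N in sequentially. real (card ({1..N} - (A + A))) \<ge> (1 - \<beta> - \<epsilon>) * real N"
      proof eventually_elim
        case (elim N)
        have "card {n \<in> {1..N}. frac (real n * \<theta>) \<in> {\<beta>..<1}} \<le> card ({1..N} - (A + A))"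
          by (intro card_mono sub) auto
        with elim show ?case by simp
      qed
    qed
  qed
qed

section \<open>Realization by subsets of the circle\<close>

text \<open>The preimage of the image is the union of all integer translates of \<open>S\<close>,
  each of them open.\<close>

lemma open_to_circle_image:
  assumes "open S"
  shows "open (to_circle ` S)"
proof -
  have "to_circle -` to_circle ` S = (\<Union>n::int. (\<lambda>x. x - of_int n) -` S)"
  proof (intro equalityI subsetI)
    fix x assume "x \<in> to_circle -` to_circle ` S"
    then obtain s where s: "s \<in> S" "x - s \<in> \<int>" by (auto simp: to_circle_eq_iff)
    then obtain n :: int where "x - s = of_int n" by (auto elim: Ints_cases)
    hence "x - of_int n = s" by simp
    thus "x \<in> (\<Union>n::int. (\<lambda>x. x - of_int n) -` S)" using s by blast
  next
    fix x assume "x \<in> (\<Union>n::int. (\<lambda>x. x - of_int n) -` S)"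
    then obtain n :: int where "x - of_int n \<in> S" by blast
    moreover have "to_circle x = to_circle (x - of_int n)" by (simp add: to_circle_eq_iff)
    ultimately show "x \<in> to_circle -` to_circle ` S" by blast
  qed
  moreover have "open (\<Union>n::int. (\<lambda>x. x - of_int n) -` S)"
    by (intro open_UN ballI open_vimage assms continuous_intros)
  ultimately show ?thesis by (simp add: open_circle_def)
qed

lemma to_circle_image_plus: "to_circle ` S + to_circle ` S = to_circle ` (S + S)"
proof (intro equalityI subsetI)
  fix z assume "z \<in> to_circle ` S + to_circle ` S"
  then obtain x y where "x \<in> S" "y \<in> S" "z = to_circle (x + y)"
    by (auto simp: to_circle_add elim!: set_plus_elim)
  thus "z \<in> to_circle ` (S + S)" by blast
next
  fix z assume "z \<in> to_circle ` (S + S)"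
  then obtain x y where "x \<in> S" "y \<in> S" "z = to_circle x + to_circle y"
    by (auto simp: to_circle_add elim!: set_plus_elim)
  thus "z \<in> to_circle ` S + to_circle ` S" by (auto intro: set_plus_intro)
qed

lemma inj_on_to_circle: "inj_on to_circle {0..<1}"
proof (rule inj_onI)
  fix x y :: real assume xy: "x \<in> {0..<1}" "y \<in> {0..<1}" "to_circle x = to_circle y"
  then obtain n :: int where "x - y = of_int n" by (auto simp: to_circle_eq_iff elim: Ints_cases)
  moreover have "\<bar>x - y\<bar> < 1" using xy by auto
  ultimately have "\<bar>real_of_int n\<bar> < 1" by simp
  hence "n = 0" by linarith
  thus "x = y" using \<open>x - y = of_int n\<close> by simp
qed

lemma emeasure_haar_to_circle_image:
  assumes "S \<subseteq> {0..<1}" "to_circle ` S \<in> sets borel"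
  shows "emeasure haar (to_circle ` S) = emeasure lborel S"
proof -
  have "to_circle -` to_circle ` S \<inter> {0..<1} = S"
  proof (intro equalityI subsetI)
    fix x assume "x \<in> to_circle -` to_circle ` S \<inter> {0..<1}"
    then obtain s where "s \<in> S" "to_circle x = to_circle s" "x \<in> {0..<1}" by auto
    thus "x \<in> S" using inj_onD[OF inj_on_to_circle, of x s] assms(1) by auto
  qed (use assms(1) in auto)
  thus ?thesis using emeasure_haar[OF assms(2)] by simp
qed

text \<open>This covers sumsets whose real representative overflows [0,1), where Lebesgue measure no
  longer equals Haar measure.\<close>

lemma measure_haar_eq_1:
  assumes "to_circle ` {0<..<1} \<subseteq> X" "X \<in> sets borel"
  shows "measure haar X = 1"
proof -
  have "to_circle ` {0<..<1::real} \<in> sets borel" by (intro borel_open open_to_circle_image) simp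
  hence "emeasure haar (to_circle ` {0<..<1}) = emeasure lborel {0<..<1::real}"
    by (intro emeasure_haar_to_circle_image) auto
  moreover have "emeasure haar (to_circle ` {0<..<1}) \<le> emeasure haar X" "emeasure haar X \<le> emeasure haar UNIV"
    using assms by (auto intro!: emeasure_mono)
  ultimately have "emeasure haar X = 1" by (simp add: emeasure_haar_UNIV)
  thus ?thesis by (simp add: measure_def)
qed

section \<open>Finite unions of intervals with a prescribed measure and sumset\<close>

text \<open>Divide (0,L) into \<open>m\<close> cells of length \<open>e\<close>. The first and last
  cells are filled, and each middle cell keeps a short interval of length \<open>\<delta>\<close> at
  its left end. A left end plus a point of the first cell reaches the lower half of (0,2L);
  replacing the first cell by the last reaches the upper half.\<close>

lemma spread_intervals:
  fixes \<alpha> L :: real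
  assumes "0 < \<alpha>" "\<alpha> \<le> L"
  obtains m :: nat and a b :: "nat \<Rightarrow> real" where
    "\<And>j. j < m \<Longrightarrow> 0 \<le> a j \<and> a j < b j \<and> b j \<le> L"
    "measure lborel (\<Union>j<m. {a j<..<b j}) = \<alpha>"
    "(\<Union>j<m. {a j<..<b j}) + (\<Union>j<m. {a j<..<b j}) = {0<..<2 * L}"
proof -
  have "L > 0" using assms by simp
  \<comment> \<open>There are \<open>n\<close> middle cells and two end cells, with \<open>m\<close>
    so large that the end cells use up less than \<alpha>; \<open>\<delta>\<close> then distributes
    the remaining measure.\<close>
  define n where "n = Suc (nat \<lceil>2 * L / \<alpha>\<rceil>)"
  define m where "m = n + 2"
  have "2 * L / \<alpha> < real m" by (simp add: m_def n_def) linarith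
  hence 2: "2 * L < \<alpha> * real m" using assms by (simp add: field_simps)
  have m: "m \<ge> 3" "n \<ge> 1" "real m = real n + 2" by (auto simp: m_def n_def)
  define e where "e = L / m"
  have e: "e > 0" "real m * e = L" "2 * e < \<alpha>" using \<open>L > 0\<close> m 2 by (auto simp: e_def field_simps)
  define \<delta> where "\<delta> = (\<alpha> - 2 * e) / n"
  have n\<delta>: "real n * \<delta> = \<alpha> - 2 * e" using m by (simp add: \<delta>_def)
  have "\<delta> > 0" using e m by (auto simp: \<delta>_def)
  have "real n * e = L - 2 * e" using e m by (simp add: algebra_simps)
  hence "real n * \<delta> \<le> real n * e" using n\<delta> assms by linarith
  hence "\<delta> \<le> e" using m by simp
  define w where "w j = (if j = 0 \<or> j = n + 1 then e else \<delta>)" for j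
  have w: "0 < w j" "w j \<le> e" for j using e \<open>\<delta> > 0\<close> \<open>\<delta> \<le> e\<close> by (auto simp: w_def)
  define a where "a j = real j * e" for j
  define b where "b j = a j + w j" for j
  define S where "S = (\<Union>j<m. {a j<..<b j})"
  have step: "a j + e \<le> a k" if "j < k" for j k
  proof -
    have "(real j + 1) * e \<le> real k * e" using that e by (intro mult_right_mono) auto
    thus ?thesis by (simp add: a_def algebra_simps)
  qed
  have am: "a m = L" using e by (simp add: a_def)
  have ab: "0 \<le> a j \<and> a j < b j \<and> b j \<le> L" if "j < m" for j
    using w[of j] step[OF that] am e by (auto simp: b_def a_def)
  have meas: "measure lborel S = \<alpha>"
  proof -
    have disj: "disjoint_family_on (\<lambda>j. {a j<..<b j}) {..<m}"
    unfolding disjoint_family_on_def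
    proof (intro ballI impI)
      fix j k :: nat assume "j \<noteq> k"
      hence "a j + e \<le> a k \<or> a k + e \<le> a j" using step[of j k] step[of k j] by linarith
      thus "{a j<..<b j} \<inter> {a k<..<b k} = {}" using w[of j] w[of k] by (auto simp: b_def)
    qed
    have "measure lborel S = (\<Sum>j<m. measure lborel {a j<..<b j})"
      unfolding S_def
      by (rule measure_finite_Union) (use disj ab in \<open>auto simp: less_imp_le\<close>)
    also have "\<dots> = (\<Sum>j<m. w j)" using w by (intro sum.cong) (auto simp: b_def less_imp_le)
    also have "\<dots> = w 0 + (\<Sum>j<n. w (Suc j)) + w (n + 1)"
    proof -
      have "(\<Sum>j<Suc (Suc n). w j) = (\<Sum>j<Suc n. w j) + w (Suc n)" by (rule sum.lessThan_Suc)
      also have "(\<Sum>j<Suc n. w j) = w 0 + (\<Sum>j<n. w (Suc j))" by (rule sum.lessThan_Suc_shift)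
      finally show ?thesis by (simp add: m_def)
    qed
    also have "\<dots> = \<alpha>" using n\<delta> by (simp add: w_def)
    finally show ?thesis .
  qed
  have SI: "x \<in> S" if "j < m" "a j < x" "x < b j" for x j
    using that by (auto simp: S_def)
  have "S \<subseteq> {0<..<L}"
  proof
    fix x assume "x \<in> S"
    then obtain j where "j < m" "a j < x" "x < b j" by (auto simp: S_def)
    thus "x \<in> {0<..<L}" using ab[of j] by simp
  qed
  hence "S + S \<subseteq> {0<..<L} + {0<..<L}" by (intro set_plus_mono2)
  also have "\<dots> \<subseteq> {0<..<2 * L}" by (auto elim!: set_plus_elim)
  finally have "S + S \<subseteq> {0<..<2 * L}" .
  moreover have "{0<..<2 * L} \<subseteq> S + S"
  proof
    fix z assume z: "z \<in> {0<..<2 * L}"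
    have cell: "\<exists>k<m. a k < y \<and> y \<le> a k + e" if "0 < y" "y \<le> L" for y
    proof -
      \<comment> \<open>Ceiling minus one, not floor: cells are closed on the right, so that y = L
        is allowed and y lies strictly above \<open>a k\<close>, which leaves room for a positive
        shift \<open>s\<close>.\<close>
      define k where "k = nat (\<lceil>y / e\<rceil> - 1)"
      have "0 < y / e" using that e by simp
      hence k: "real k = of_int \<lceil>y / e\<rceil> - 1" by (simp add: k_def)
      hence "real k < y / e" "y / e \<le> real k + 1" by linarith+
      hence "a k < y" "y \<le> a k + e" using e by (auto simp: a_def field_simps)
      moreover have "k < m"
      proof (rule ccontr)
        assume "\<not> k < m"
        hence "real m * e \<le> a k" using e unfolding a_def by (intro mult_right_mono) auto
        thus False using \<open>a k < y\<close> that e by simp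
      qed
      ultimately show ?thesis by blast
    qed
    have ends: "x \<in> S" if "0 < x \<and> x < e \<or> L - e < x \<and> x < L" for x
      using that SI[of 0 x] SI[of "n + 1" x] m e am
      by (auto simp: b_def w_def a_def m_def algebra_simps)
    consider "z \<le> L" | "L < z" "z \<le> 2 * L - e" | "2 * L - e < z" "z < 2 * L" using z by fastforce
    thus "z \<in> S + S"
    proof cases
      case 1
      then obtain k where k: "k < m" "a k < z" "z \<le> a k + e" using cell[of z] z by auto
      \<comment> \<open>A positive shift small enough to keep \<open>a k + s\<close> in the interval
        of cell \<open>k\<close> and to leave the remainder \<open>z - a k - s\<close> strictly
        inside the first cell.\<close>
      define s where "s = min (w k) (z - a k) / 2"
      have s: "0 < s" "s < w k" "s < z - a k" using k w[of k] by (auto simp: s_def min_def field_simps)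
      have "a k + s \<in> S" using k s by (intro SI[of k]) (auto simp: b_def)
      moreover have "z - a k - s \<in> S" using k s by (intro ends) auto
      ultimately show ?thesis using set_plus_intro[of "a k + s" S "z - a k - s" S] by simp
    next
      case 2
      have "\<exists>k<m. a k + L - e < z \<and> z \<le> a k + L"
      proof -
        obtain k where "k < m" "a k < z - (L - e)" "z - (L - e) \<le> a k + e" 
          using cell[of "z - (L - e)"] 2 e by auto
        thus ?thesis by (intro exI[of _ k]) auto
      qed
      then obtain k where k: "k < m" "a k + L - e < z" "z \<le> a k + L" by blast
      define s where "s = min (w k) (z - (a k + L - e)) / 2"
      have s: "0 < s" "s < w k" "s < z - (a k + L - e)" using k w[of k] by (auto simp: s_def min_def field_simps)
      have "a k + s \<in> S" using k s by (intro SI[of k]) (auto simp: b_def)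
      moreover have "z - a k - s \<in> S" using k s by (intro ends) auto
      ultimately show ?thesis using set_plus_intro[of "a k + s" S "z - a k - s" S] by simp
    next
      case 3
      have "z / 2 \<in> S" using 3 e by (intro ends) auto
      thus ?thesis using set_plus_intro[of "z / 2" S "z / 2" S] by simp
    qed
  qed
  ultimately show thesis using that[of m a b] ab meas unfolding S_def by blast
qed

section \<open>Null sets with large sumset, by Baire category\<close>

text \<open>The rationals are null, so outer regularity encloses them in open sets of measure below
  1/(i+1). Each of these is dense because it contains the rationals.\<close>

lemma null_comeager_real:
  obtains U :: "nat \<Rightarrow> real set" where "\<And>i. open (U i)" "\<And>i. \<rat> \<subseteq> U i" "emeasure lborel (\<Inter>i. U i) = 0"
proof -
  have ex: "\<forall>i. \<exists>U :: real set. open U \<and> \<rat> \<subseteq> U \<and> emeasure lborel U < ennreal (1 / real (Suc i))"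
  proof
    fix i :: nat
    have null: "(\<rat> :: real set) \<in> null_sets lborel"
      by (rule countable_imp_null_set_lborel[OF countable_rat])
    hence "(\<rat> :: real set) \<in> sets borel" by (simp add: null_sets_def)
    then obtain U where U: "open U" "(\<rat> :: real set) \<subseteq> U" "emeasure lborel (U - \<rat>) < ennreal (1 / real (Suc i))"
      by (rule outer_regular_lborel[where e = "1 / real (Suc i)"]) simp
    have eq: "emeasure lborel (U - \<rat>) = emeasure lborel U"
      using U(1) null by (intro emeasure_Diff_null_set) auto
    show "\<exists>U :: real set. open U \<and> \<rat> \<subseteq> U \<and> emeasure lborel U < ennreal (1 / real (Suc i))"
      using U unfolding eq by (intro exI[of _ U] conjI)
  qed
  from choice[OF ex] obtain U :: "nat \<Rightarrow> real set" where
    "\<forall>i. open (U i) \<and> \<rat> \<subseteq> U i \<and> emeasure lborel (U i) < ennreal (1 / real (Suc i))" ..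
  hence U: "open (U i)" "\<rat> \<subseteq> U i" "emeasure lborel (U i) < ennreal (1 / real (Suc i))" for i
    by simp_all
  have "emeasure lborel (\<Inter>i. U i) \<le> 0 + ennreal \<epsilon>" if pos: "\<epsilon> > 0" for \<epsilon>
  proof -
    obtain i :: nat where i: "1 / real (Suc i) < \<epsilon>" by (rule nat_approx_posE[OF pos])
    have "emeasure lborel (\<Inter>i. U i) \<le> emeasure lborel (U i)" by (intro emeasure_mono INT_lower) (auto simp: U(1))
    also have "\<dots> \<le> ennreal (1 / real (Suc i))" using U(3) by (rule less_imp_le)
    also have "\<dots> \<le> ennreal \<epsilon>" using i by (intro ennreal_leI) simp
    finally show ?thesis by simp
  qed
  hence "emeasure lborel (\<Inter>i. U i) \<le> 0" using ennreal_le_epsilon by blast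
  hence "emeasure lborel (\<Inter>i. U i) = 0" by simp
  thus thesis by (intro that[of U] U(1,2))
qed

lemma dense_real:
  fixes T :: "real set"
  assumes "\<And>a b. a < b \<Longrightarrow> \<exists>x\<in>T. a < x \<and> x < b"
  shows "UNIV \<subseteq> closure T"
proof
  fix x :: real
  have "\<exists>y\<in>T. dist y x < e" if "e > 0" for e
    using assms[of x "x + e"] that by (force simp: dist_real_def)
  thus "x \<in> closure T" by (simp add: closure_approachable)
qed

text \<open>For fixed z the sets \<open>U i\<close> and their reflections z - \<open>U i\<close> are
  all open and dense. By Baire some x lies in all of them, so x and z - x both belong to the
  intersection.\<close>

lemma comeager_sumset:
  fixes U :: "nat \<Rightarrow> real set" and L :: real
  assumes U: "\<And>i. open (U i)" "\<And>i. \<rat> \<subseteq> U i"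
  assumes S: "S = (\<Inter>i. U i) \<inter> {0<..<L}"
  shows "S + S = {0<..<2 * L}"
proof
  show "S + S \<subseteq> {0<..<2 * L}" by (auto simp: S elim!: set_plus_elim)
  show "{0<..<2 * L} \<subseteq> S + S"
  proof
    fix z assume z: "z \<in> {0<..<2 * L}"
    have dense: "UNIV \<subseteq> closure (U i)" for i
      by (intro dense_real) (meson Rats_dense_in_real U(2) subsetD)
    have dense': "UNIV \<subseteq> closure ((\<lambda>x. z - x) -` U i)" for i
    proof (rule dense_real)
      fix a b :: real assume "a < b"
      then obtain r where "r \<in> \<rat>" "z - b < r" "r < z - a"
        using Rats_dense_in_real[of "z - b" "z - a"] by auto
      thus "\<exists>x\<in>(\<lambda>x. z - x) -` U i. a < x \<and> x < b"
        using U(2) by (intro bexI[of _ "z - r"]) auto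
    qed
    define G where "G = range U \<union> range (\<lambda>i. (\<lambda>x. z - x) -` U i)"
    have "UNIV \<subseteq> closure (\<Inter>G)"
    proof (rule Baire)
      show "countable G" by (auto simp: G_def)
      fix T assume "T \<in> G"
      moreover have "open ((\<lambda>x. z - x) -` U i)" for i by (intro open_vimage U continuous_intros)
      ultimately show "openin (top_of_set UNIV) T \<and> UNIV \<subseteq> closure T"
        using U(1) dense dense' unfolding G_def by (elim UnE rangeE) simp_all
    qed auto
    hence cl: "closure (\<Inter>G) = UNIV" by auto
    \<comment> \<open>Exactly the x for which x and z - x both lie in (0,L); nonempty since 0 < z <
      2L.\<close>
    define I where "I = {max 0 (z - L)<..<min z L}"
    have "I \<inter> closure (\<Inter>G) \<noteq> {}" using z unfolding cl I_def by auto
    hence "I \<inter> \<Inter>G \<noteq> {}" using open_Int_closure_eq_empty[of I "\<Inter>G"] by (auto simp: I_def)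
    then obtain x where x: "x \<in> I" "x \<in> \<Inter>G" by blast
    hence "x \<in> S" "z - x \<in> S" by (auto simp: S G_def I_def)
    thus "z \<in> S + S" using set_plus_intro[of x S "z - x" S] by simp
  qed
qed

section \<open>The circle realization\<close>

text \<open>Three regimes: a single arc longer than half the circle, spread intervals inside (0,
  \<beta>/2), and a null comeager part of that interval. In the last two the real sumset (0,
  \<beta>) stays within one fundamental domain, so its Haar measure is \<beta>.\<close>

lemma circle_sumset_realization:
  fixes \<alpha> \<beta> :: real
  assumes "0 \<le> \<alpha>" "\<alpha> \<le> 1" "0 \<le> \<beta>" "\<beta> \<le> 1" and ab: "2 * \<alpha> \<le> \<beta> \<or> 1 < 2 * \<alpha> \<and> \<beta> = 1"
  obtains A :: "circle set" where "A \<in> sets haar" "A + A \<in> sets haar" "measure haar A = \<alpha>"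
    "measure haar (A + A) = \<beta>" "\<alpha> > 0 \<Longrightarrow> finite_union_open_intervals A"
proof -
  have open_sets: "to_circle ` S \<in> sets borel" if "open S" for S
    using that by (intro borel_open open_to_circle_image)
  have meas: "measure haar (to_circle ` S) = measure lborel S"
    if "S \<subseteq> {0..<1}" "to_circle ` S \<in> sets borel" for S
    using emeasure_haar_to_circle_image[OF that] by (simp add: measure_def)
  consider "1 < 2 * \<alpha>" "\<beta> = 1" | "0 < \<alpha>" "2 * \<alpha> \<le> \<beta>" | "\<alpha> = 0" using ab assms by linarith
  thus thesis
  proof cases
    case 1
    define S where "S = {0<..<\<alpha>}"
    define A where "A = to_circle ` S"
    have "S + S = (\<Union>x\<in>S. \<Union>y\<in>S. {x + y})" by (auto simp: set_plus_def)
    hence "open (S + S)" using open_sums[of S S] by (simp add: S_def)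
    hence AA: "A + A \<in> sets borel" unfolding A_def to_circle_image_plus by (rule open_sets)
    have "{0<..<1} \<subseteq> S + S"
    proof
      fix z :: real assume "z \<in> {0<..<1}"
      hence "z / 2 \<in> S" using 1 by (simp add: S_def)
      thus "z \<in> S + S" using set_plus_intro[of "z / 2" S "z / 2" S] by simp
    qed
    hence "measure haar (A + A) = 1"
      using AA by (intro measure_haar_eq_1) (auto simp: A_def to_circle_image_plus)
    moreover have "measure haar A = \<alpha>"
      using assms unfolding A_def by (subst meas) (auto simp: S_def intro!: open_sets)
    moreover have "open_interval A"
      unfolding open_interval_def A_def S_def using assms 1 by (intro exI[of _ 0] exI[of _ \<alpha>]) auto
    hence "finite_union_open_intervals A"
      unfolding finite_union_open_intervals_def by (intro exI[of _ "{A}"]) auto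
    moreover have "A \<in> sets borel" by (simp add: A_def S_def open_sets)
    ultimately show thesis using AA 1 by (intro that[of A]) auto
  next
    case 2
    hence "\<alpha> \<le> \<beta> / 2" by simp
    obtain m :: nat and a b :: "nat \<Rightarrow> real" where I: "\<And>j. j < m \<Longrightarrow> 0 \<le> a j \<and> a j < b j \<and> b j \<le> \<beta> / 2"
      and S1: "measure lborel (\<Union>j<m. {a j<..<b j}) = \<alpha>"
      and S2: "(\<Union>j<m. {a j<..<b j}) + (\<Union>j<m. {a j<..<b j}) = {0<..<2 * (\<beta> / 2)}"
      by (rule spread_intervals[OF 2(1) \<open>\<alpha> \<le> \<beta> / 2\<close>]) blast
    define S where "S = (\<Union>j<m. {a j<..<b j})"
    have I': "0 \<le> a j" "a j < b j" "b j \<le> 1 / 2" if "j < m" for j using I[OF that] assms by auto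
    have S: "measure lborel S = \<alpha>" "S + S = {0<..<\<beta>}" "open S"
      using S1 S2 by (simp_all add: S_def open_UN)
    have S01: "S \<subseteq> {0..<1}"
    proof
      fix x assume "x \<in> S"
      then obtain j where "j < m" "a j < x" "x < b j" by (auto simp: S_def)
      thus "x \<in> {0..<1}" using I'[of j] by simp
    qed
    define A where "A = to_circle ` S"
    have AA: "A + A = to_circle ` {0<..<\<beta>}" by (simp add: A_def to_circle_image_plus S)
    have "measure haar (A + A) = \<beta>" unfolding AA using assms by (subst meas) (auto intro!: open_sets)
    moreover have "measure haar A = \<alpha>" unfolding A_def using S S01 by (subst meas) (auto intro!: open_sets)
    moreover have "finite_union_open_intervals A"
    proof -
      have "open_interval (to_circle ` {a j<..<b j})" if "j < m" for j
        unfolding open_interval_def using I'[OF that] by (intro exI[of _ "a j"] exI[of _ "b j"]) auto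
      thus ?thesis unfolding finite_union_open_intervals_def
        by (intro exI[of _ "(\<lambda>j. to_circle ` {a j<..<b j}) ` {..<m}"]) (auto simp: A_def S_def)
    qed
    moreover have "A \<in> sets borel" unfolding A_def by (intro open_sets S)
    moreover have "A + A \<in> sets borel" unfolding AA by (intro open_sets) simp
    ultimately show thesis by (intro that[of A]) auto
  next
    case 3
    obtain U :: "nat \<Rightarrow> real set" where U: "\<And>i. open (U i)" "\<And>i. \<rat> \<subseteq> U i" "emeasure lborel (\<Inter>i. U i) = 0"
      by (rule null_comeager_real) blast
    \<comment> \<open>When \<beta> = 0 this set is empty, and so are \<open>A\<close> and
      \<open>A + A\<close>, with the required measure 0.\<close>
    define S where "S = (\<Inter>i. U i) \<inter> {0<..<\<beta> / 2}"
    have SS: "S + S = {0<..<\<beta>}" using comeager_sumset[OF U(1,2) S_def] by simp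
    have S1: "S \<subseteq> {0..<1}" using assms by (auto simp: S_def)
    define A where "A = to_circle ` S"
    \<comment> \<open>Injectivity of \<open>to_circle\<close> on [0,1) lets the image commute with
      the intersection, which exhibits \<open>A\<close> as a countable intersection of open sets and
      hence as Borel.\<close>
    have "A = (\<Inter>i. to_circle ` (U i \<inter> {0<..<\<beta> / 2}))"
    proof -
      have "S = (\<Inter>i. U i \<inter> {0<..<\<beta> / 2})" by (auto simp: S_def)
      moreover have "to_circle ` (\<Inter>i. U i \<inter> {0<..<\<beta> / 2}) = (\<Inter>i. to_circle ` (U i \<inter> {0<..<\<beta> / 2}))"
        by (rule image_INT[OF inj_on_to_circle, where j = 0]) (use assms in auto)
      ultimately show ?thesis by (simp add: A_def)
    qed
    also have "\<dots> \<in> sets borel" using U(1) by (intro sets.countable_INT'' open_sets open_Int) auto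
    finally have A: "A \<in> sets borel" .
    have "(\<Inter>i. U i) \<in> sets borel" using U(1) by (intro sets.countable_INT'') auto
    hence "emeasure lborel S \<le> emeasure lborel (\<Inter>i. U i)" by (intro emeasure_mono) (auto simp: S_def)
    hence "emeasure lborel S = 0" using U(3) by simp
    moreover have "measure haar A = measure lborel S" using A S1 unfolding A_def by (intro meas)
    ultimately have "measure haar A = 0" by (simp add: measure_def)
    moreover have AA: "A + A = to_circle ` {0<..<\<beta>}" by (simp add: A_def to_circle_image_plus SS)
    moreover have "measure haar (A + A) = \<beta>" unfolding AA using assms by (subst meas) (auto intro!: open_sets)
    moreover have "A + A \<in> sets borel" unfolding AA by (intro open_sets) simp
    ultimately show thesis using A 3 by (intro that[of A]) auto
  qed
qed

theorem theorem1p1: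
  fixes \<alpha> \<beta> :: real
  assumes "\<alpha> \<in> {0..1}" and "\<beta> \<in> {0..1}" and "\<beta> \<ge> min (2 * \<alpha>) 1"
  shows "(\<exists>A :: nat set. A \<subseteq> {1..} \<and> has_density A \<alpha> \<and> has_density (A + A) \<beta>) \<and>
    (\<exists>A :: circle set. A \<in> sets haar \<and> A + A \<in> sets haar \<and>
        measure haar A = \<alpha> \<and> measure haar (A + A) = \<beta> \<and>
        (\<alpha> > 0 \<longrightarrow> finite_union_open_intervals A))"
proof -
  have "2 * \<alpha> \<le> \<beta> \<or> 1 < 2 * \<alpha> \<and> \<beta> = 1" using assms by (auto simp: min_def split: if_splits)
  moreover have "0 \<le> \<alpha>" "\<alpha> \<le> 1" "0 \<le> \<beta>" "\<beta> \<le> 1" using assms by auto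
  moreover obtain A :: "nat set" where "A \<subseteq> {1..}" "has_density A \<alpha>" "has_density (A + A) \<beta>"
    by (rule density_sumset_realization[of \<alpha> \<beta>]) (use calculation in auto)
  moreover obtain B :: "circle set" where "B \<in> sets haar" "B + B \<in> sets haar" "measure haar B = \<alpha>"
    "measure haar (B + B) = \<beta>" "\<alpha> > 0 \<Longrightarrow> finite_union_open_intervals B"
    by (rule circle_sumset_realization[of \<alpha> \<beta>]) (use calculation in auto)
  ultimately show ?thesis by blast
qed

end
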